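(* There exists $N \in \mathbb{N}$ such that for every $n \geq N$ and every convex set $A \subset \mathbb{R}$ with $|A| = n$, there exists a matching $M \subset A \times A$ with $|M| \geq \sqrt{n}$ such that the set $A -_M A := \{a - b : (a,b) \in M\}$ is convex.
   Context: A finite set $B = \{b_1 < b_2 < \dots < b_m\} \subset \mathbb{R}$ is called convex if its consecutive differences are strictly increasing, i.e. $b_{i+1} - b_i > b_i - b_{i-1}$ for all $i = 2, \dots, m-1$. A set $M \subset A \times A$ is a matching if its elements are pairwise disjoint, i.e. no element of $A$ occurs as a coordinate of two distinct pairs of $M$. *)

theory Defs
  imports Complex_Main
begin

text \<open>
  Convexity of a finite set of reals in the sense of additive combinatorics (strictly increasing
  consecutive differences); this is unrelated to the geometric predicate \<open>convex\<close> of HOL-Analysis.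
  The list \<open>sorted_list_of_set B\<close> enumerates \<open>B\<close> increasingly, with indices starting at 0. Sets with
  at most two elements satisfy the condition vacuously.
\<close>

definition gap_convex :: "real set \<Rightarrow> bool" where
  "gap_convex B \<longleftrightarrow> finite B \<and>
     (let b = sorted_list_of_set B in
       \<forall>i. 1 \<le> i \<and> i + 1 < card B \<longrightarrow> b ! (i + 1) - b ! i > b ! i - b ! (i - 1))"

definition matching_on :: "'a set \<Rightarrow> ('a \<times> 'a) set \<Rightarrow> bool" where
  "matching_on A M \<longleftrightarrow> M \<subseteq> A \<times> A \<and>
     (\<forall>p\<in>M. \<forall>q\<in>M. p \<noteq> q \<longrightarrow> {fst p, snd p} \<inter> {fst q, snd q} = {})"

definition diffs_along :: "(real \<times> real) set \<Rightarrow> real set" where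
  "diffs_along M = {a - b | a b. (a, b) \<in> M}"

end

theory Submission
  imports Defs
begin

text \<open>
  Write \<open>A = {a 0 < a 1 < \<dots>}\<close> and split it at index \<open>m\<close>. In the pairs
  \<open>(a (m + j (j + 1) / 2), a (m - 1 - j))\<close>, \<open>j < m\<close>, the second coordinate descends by one gap at
  each step, while the first climbs over \<open>j + 1\<close> gaps in step \<open>j\<close>. Each gap above the splitting
  point exceeds each gap below it, so the additional gap climbed in the next step outweighs the
  decrease of the gaps descended, and the differences are convex. About \<open>m\<^sup>2 / 2\<close> elements are
  used, so \<open>m\<close> can be as large as the rounded-up square root of \<open>n\<close>.
\<close>

lemma sorted_list_of_set_image_lessThan:
  fixes f :: "nat \<Rightarrow> 'a::linorder"
  assumes "strict_mono_on {..<m} f"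
  shows "sorted_list_of_set (f ` {..<m}) = map f [0..<m]"
proof -
  have "sorted_wrt (<) (map f [0..<m])"
    using assms by (auto simp: sorted_wrt_iff_nth_less strict_mono_on_def)
  then have "sorted_list_of_set (set (map f [0..<m])) = map f [0..<m]"
    by (metis sorted_list_of_set.idem_if_sorted_distinct strict_sorted_iff)
  then show ?thesis
    by (simp add: atLeast0LessThan)
qed

lemma gap_convex_image_lessThan:
  fixes f :: "nat \<Rightarrow> real"
  assumes mono: "strict_mono_on {..<m} f"
    and convex: "\<And>j. j + 2 < m \<Longrightarrow> f (j + 1) - f j < f (j + 2) - f (j + 1)"
  shows "gap_convex (f ` {..<m})"
proof -
  have card: "card (f ` {..<m}) = m"
    using mono by (simp add: card_image strict_mono_on_imp_inj_on)
  have "f i - f (i - 1) < f (i + 1) - f i" if "1 \<le> i" "i + 1 < m" for i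
    using convex[of "i - 1"] that by simp
  then show ?thesis
    using card by (auto simp: gap_convex_def Let_def sorted_list_of_set_image_lessThan[OF mono])
qed

lemma gap_convexE:
  assumes "gap_convex A" "card A = n"
  obtains a where "A = a ` {..<n}" "strict_mono_on {..<n} a"
    "\<And>i. i + 2 < n \<Longrightarrow> a (i + 1) - a i < a (i + 2) - a (i + 1)"
proof
  let ?a = "nth (sorted_list_of_set A)"
  have fin: "finite A"
    using assms by (simp add: gap_convex_def)
  have len: "length (sorted_list_of_set A) = n"
    using assms by simp
  show "A = ?a ` {..<n}"
    using fin len by (metis atLeast0LessThan nth_image order_refl set_sorted_list_of_set take_all)
  show "strict_mono_on {..<n} ?a"
    using len strict_sorted_list_of_set[of A]
    by (auto simp: strict_mono_on_def sorted_wrt_iff_nth_less)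
  show "?a (i + 1) - ?a i < ?a (i + 2) - ?a (i + 1)" if "i + 2 < n" for i
  proof -
    have "\<forall>i. 1 \<le> i \<and> i + 1 < n \<longrightarrow> ?a (i + 1) - ?a i > ?a i - ?a (i - 1)"
      using assms by (auto simp: gap_convex_def Let_def)
    from this[rule_format, of "i + 1"] that show ?thesis by simp
  qed
qed

lemma gap_strict_mono:
  fixes a :: "nat \<Rightarrow> real"
  assumes convex: "\<And>i. i + 2 < n \<Longrightarrow> a (i + 1) - a i < a (i + 2) - a (i + 1)"
    and "i < k" "k + 1 < n"
  shows "a (i + 1) - a i < a (k + 1) - a k"
  using assms(2,3)
proof (induction k)
  case (Suc k)
  then show ?case
    using convex[of k] by (cases "i = k") auto
qed simp

text \<open>The two blocks of \<open>k\<close> consecutive gaps are compared gap by gap, and the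
  sums telescope. They may overlap, since only \<open>p < q\<close> matters. The inequality is weak
  because \<open>k = 0\<close> is allowed.\<close>

lemma block_gap_mono:
  fixes a :: "nat \<Rightarrow> real"
  assumes convex: "\<And>i. i + 2 < n \<Longrightarrow> a (i + 1) - a i < a (i + 2) - a (i + 1)"
    and "p < q" "q + k < n"
  shows "a (p + k) - a p \<le> a (q + k) - a q"
  using assms(3)
proof (induction k)
  case (Suc k)
  have "a (p + k + 1) - a (p + k) < a (q + k + 1) - a (q + k)"
    using Suc.prems \<open>p < q\<close> by (intro gap_strict_mono[OF convex]) auto
  with Suc show ?case by simp
qed simp

text \<open>The sum form gives the recursion for the climbing index without
  \<open>div\<close>.\<close>

definition triangular :: "nat \<Rightarrow> nat" where
  "triangular j = \<Sum>{..j}"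

lemma triangular_Suc: "triangular (Suc j) = triangular j + Suc j"
  by (simp add: triangular_def)

lemma strict_mono_triangular: "strict_mono triangular"
  by (simp add: strict_mono_Suc_iff triangular_Suc)

lemma double_triangular: "2 * triangular j = j * (j + 1)"
  by (induction j) (auto simp: triangular_Suc triangular_def)

text \<open>The largest index occurring in the pairs is \<open>m + triangular (m - 1)\<close>,
  reached at \<open>j = m - 1\<close>, so \<open>bound\<close> keeps every pair inside
  \<open>A\<close>.\<close>

lemma convex_matching:
  fixes A :: "real set"
  assumes A: "gap_convex A" "card A = n" and bound: "m + triangular (m - 1) < n"
  obtains M where "matching_on A M" "card M = m" "inj_on (\<lambda>(a, b). a - b) M"
    "gap_convex (diffs_along M)"
proof -
  obtain a where a: "A = a ` {..<n}" "strict_mono_on {..<n} a"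
    and convex: "\<And>i. i + 2 < n \<Longrightarrow> a (i + 1) - a i < a (i + 2) - a (i + 1)"
    using gap_convexE[OF A] by blast
  have inj: "inj_on a {..<n}"
    using a(2) by (rule strict_mono_on_imp_inj_on)
  let ?t = "\<lambda>j. m + triangular j" and ?s = "\<lambda>j. m - 1 - j"
  let ?p = "\<lambda>j. (a (?t j), a (?s j))"
  let ?D = "\<lambda>j. a (?t j) - a (?s j)"
  let ?M = "?p ` {..<m}"
  have t_less: "?t j < n" if "j < m" for j
  proof -
    have "triangular j \<le> triangular (m - 1)"
      using that by (simp add: strict_mono_less_eq[OF strict_mono_triangular])
    with bound show ?thesis by simp
  qed
  have s_less: "?s j < n" for j
    using bound by simp
  \<comment> \<open>First coordinates have index at least \<open>m\<close>, second coordinates index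
    below \<open>m\<close>, so the two kinds never meet.\<close>
  have st: "?s j < ?t k" if "j < m" for j k
    using that by simp

  have D_mono: "strict_mono_on {..<m} ?D"
  proof (rule strict_mono_onI)
    fix j k assume jk: "j \<in> {..<m}" "k \<in> {..<m}" "j < k"
    have "a (?t j) < a (?t k)"
      using jk t_less strict_monoD[OF strict_mono_triangular, of j k]
      by (intro strict_mono_onD[OF a(2)]) auto
    moreover have "a (?s k) < a (?s j)"
      using jk s_less by (intro strict_mono_onD[OF a(2)]) auto
    ultimately show "?D j < ?D k" by simp
  qed
  have D_convex: "?D (j + 1) - ?D j < ?D (j + 2) - ?D (j + 1)" if j: "j + 2 < m" for j
  proof -
    define p q r where "p = ?t j" and "q = ?t (j + 1)" and "r = m - 3 - j"
    have t1: "q = p + (j + 1)" and t2: "?t (j + 2) = q + (j + 1) + 1"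
      by (simp_all add: p_def q_def triangular_Suc)
    have s: "?s j = r + 2" "?s (j + 1) = r + 1" "?s (j + 2) = r"
      using j by (auto simp: r_def)
    have n: "q + (j + 1) + 1 < n"
      using t_less[of "j + 2"] j t2 by simp
    \<comment> \<open>The later step climbs \<open>j + 2\<close> gaps from \<open>q\<close>. The
      first \<open>j + 1\<close> of them make up for the climb from \<open>p\<close> to
      \<open>q\<close>, the last one exceeds the gap from \<open>r + 1\<close> to
      \<open>r + 2\<close> descended before, and the gap from \<open>r\<close> to
      \<open>r + 1\<close> only has to be positive.\<close>
    have "a (p + (j + 1)) - a p \<le> a (q + (j + 1)) - a q"
      using n t1 by (intro block_gap_mono[OF convex]) auto
    moreover have "a (r + 1 + 1) - a (r + 1) < a (q + (j + 1) + 1) - a (q + (j + 1))"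
      using n j by (intro gap_strict_mono[OF convex]) (auto simp: q_def r_def)
    moreover have "a r < a (r + 1)"
      using s_less[of "j + 1"] s by (intro strict_mono_onD[OF a(2)]) auto
    ultimately show ?thesis
      unfolding s t2 p_def[symmetric] q_def[symmetric] t1[symmetric] by simp
  qed

  have D_inj: "inj_on ?D {..<m}"
    using D_mono by (rule strict_mono_on_imp_inj_on)
  have diff_p: "(\<lambda>(a, b). a - b) \<circ> ?p = ?D"
    by auto
  show thesis
  proof
    show "matching_on A ?M"
      unfolding matching_on_def
    proof (intro conjI ballI impI)
      show "?M \<subseteq> A \<times> A"
        using t_less s_less by (auto simp: a(1))
      fix x y assume "x \<in> ?M" "y \<in> ?M" "x \<noteq> y"
      then obtain j k where jk: "x = ?p j" "y = ?p k" "j < m" "k < m" "j \<noteq> k"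
        by auto
      have "?t j \<noteq> ?t k"
        using jk strict_mono_eq[OF strict_mono_triangular] by simp
      moreover have "?s j \<noteq> ?s k"
        using jk by linarith
      moreover have "?s j \<noteq> ?t k" "?s k \<noteq> ?t j"
        using st[of j k] st[of k j] jk by linarith+
      ultimately show "{fst x, snd x} \<inter> {fst y, snd y} = {}"
        using jk t_less[of j] t_less[of k] s_less[of j] s_less[of k]
        by (auto simp: inj_on_eq_iff[OF inj])
    qed
    \<comment> \<open>Equal pairs would have equal differences, so injectivity of \<open>?D\<close>
      passes to \<open>?p\<close>.\<close>
    have p_inj: "inj_on ?p {..<m}"
      using D_inj unfolding diff_p[symmetric] by (rule inj_on_imageI2)
    then show "card ?M = m"
      by (simp add: card_image)
    show "inj_on (\<lambda>(a, b). a - b) ?M"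
      using D_inj unfolding diff_p[symmetric] by (rule inj_on_imageI)
    have "diffs_along ?M = ?D ` {..<m}"
      by (auto simp: diffs_along_def)
    then show "gap_convex (diffs_along ?M)"
      using gap_convex_image_lessThan[OF D_mono D_convex] by simp
  qed
qed

text \<open>For \<open>m\<close> the rounded-up square root, \<open>(m - 1)\<^sup>2 < n\<close>, so
  \<open>m (m + 1) / 2 \<le> (m - 1)\<^sup>2\<close> suffices. This amounts to
  \<open>m\<^sup>2 - 5 m + 2 \<ge> 0\<close>, which holds from \<open>m = 5\<close> on.\<close>

lemma sqrt_matching_size:
  assumes "17 \<le> n"
  obtains m where "sqrt (real n) \<le> real m" "m + triangular (m - 1) < n"
proof -
  define m where "m = (LEAST m. n \<le> m\<^sup>2)"
  have "n \<le> n\<^sup>2"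
    by (simp add: power2_eq_square)
  then have ge: "n \<le> m\<^sup>2"
    unfolding m_def by (rule LeastI)
  \<comment> \<open>This is the source of the threshold: 17 is the least integer above
    \<open>4\<^sup>2\<close>.\<close>
  have "5 \<le> m"
  proof (rule ccontr)
    assume "\<not> 5 \<le> m"
    then have "m\<^sup>2 \<le> 4\<^sup>2"
      by (intro power_mono) auto
    with ge assms show False by simp
  qed
  then obtain k where k: "m = k + 5"
    using le_Suc_ex[of 5 m] by (auto simp: add.commute)
  have "\<not> n \<le> (k + 4)\<^sup>2"
    by (rule not_less_Least) (use k in \<open>simp flip: m_def\<close>)
  then have "(k + 4) * (k + 4) < n"
    by (simp add: power2_eq_square)
  moreover have "2 * triangular (k + 4) = (k + 4) * (k + 5)"
    using double_triangular[of "k + 4"] by simp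
  ultimately have "m + triangular (m - 1) < n"
    by (simp add: k algebra_simps)
  moreover have "sqrt (real n) \<le> real m"
    using ge by (intro real_le_lsqrt) (simp_all flip: of_nat_power)
  ultimately show thesis
    using that by blast
qed

(* Distinct pairs of M give distinct differences (the inj_on conjunct), so that the convex set
   diffs_along M has as many elements as M. Without it the diagonal M = {(a, a) | a \<in> A}, whose
   difference set is {0}, would be a witness for every A. *)
theorem theorem2:
  "\<exists>N::nat. \<forall>n\<ge>N. \<forall>A::real set. gap_convex A \<and> card A = n \<longrightarrow>
     (\<exists>M. matching_on A M \<and> real (card M) \<ge> sqrt (real n) \<and>
          inj_on (\<lambda>(a, b). a - b) M \<and> gap_convex (diffs_along M))"
proof (intro exI[of _ 17] allI impI)
  fix n :: nat and A :: "real set"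
  assume n: "17 \<le> n" and A: "gap_convex A \<and> card A = n"
  obtain m where m: "sqrt (real n) \<le> real m" "m + triangular (m - 1) < n"
    using sqrt_matching_size[OF n] by blast
  obtain M where "matching_on A M" "card M = m" "inj_on (\<lambda>(a, b). a - b) M"
    "gap_convex (diffs_along M)"
    using convex_matching[OF _ _ m(2)] A by blast
  with m(1) show "\<exists>M. matching_on A M \<and> sqrt (real n) \<le> real (card M) \<and>
      inj_on (\<lambda>(a, b). a - b) M \<and> gap_convex (diffs_along M)"
    by blast
qed

end
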